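(* Let $k\ge 1$ and $t\ge 2$ be integers, and let $G$ be a $k$-degenerate $K_{2,t}$-free graph with maximum degree $\Delta(G)$. Then $$q_B(G)\le \Delta(G)+(k-1)\min\{t-1,\Delta(G)\}.$$ If $k\ge 2$ and $t-1\ge k$, then equality is attained by the complete bipartite graph $K_{k,t-1}$ (which is $k$-degenerate and $K_{2,t}$-free).
   Context: All graphs are finite, simple and undirected. An edge-coloring is proper if incident edges receive distinct colors. A B-coloring of a graph $G$ is a proper edge-coloring in which the four edges of every $4$-cycle (not necessarily induced) receive pairwise distinct colors. The B-coloring number $q_B(G)$ is the minimum number of colors in a B-coloring of $G$. For an integer $t\ge2$, a graph is $K_{2,t}$-free if any two distinct vertices have at most $t-1$ common neighbors. A graph is $k$-degenerate if every nonempty subgraph has a vertex of degree at most $k$ in that subgraph. *)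

theory Defs
  imports Main
begin

record 'a ugraph =
  verts :: "'a set"
  edges :: "'a set set"

definition simple_graph :: "'a ugraph \<Rightarrow> bool" where
  "simple_graph G \<longleftrightarrow> finite (verts G) \<and> (\<forall>e\<in>edges G. e \<subseteq> verts G \<and> card e = 2)"

definition neighbors :: "'a ugraph \<Rightarrow> 'a \<Rightarrow> 'a set" where
  "neighbors G v = {u. {u, v} \<in> edges G}"

definition degree :: "'a ugraph \<Rightarrow> 'a \<Rightarrow> nat" where
  "degree G v = card (neighbors G v)"

text \<open>The inserted 0 only matters for the graph without vertices, whose maximum degree is 0.\<close>
definition max_degree :: "'a ugraph \<Rightarrow> nat" where
  "max_degree G = Max (insert 0 (degree G ` verts G))"

definition subgraph :: "'a ugraph \<Rightarrow> 'a ugraph \<Rightarrow> bool" where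
  "subgraph H G \<longleftrightarrow> simple_graph H \<and> verts H \<subseteq> verts G \<and> edges H \<subseteq> edges G"

definition degenerate :: "nat \<Rightarrow> 'a ugraph \<Rightarrow> bool" where
  "degenerate k G \<longleftrightarrow>
    (\<forall>H. subgraph H G \<and> verts H \<noteq> {} \<longrightarrow> (\<exists>v\<in>verts H. degree H v \<le> k))"

definition K2_free :: "nat \<Rightarrow> 'a ugraph \<Rightarrow> bool" where
  "K2_free t G \<longleftrightarrow>
    (\<forall>u\<in>verts G. \<forall>v\<in>verts G. u \<noteq> v \<longrightarrow> card (neighbors G u \<inter> neighbors G v) \<le> t - 1)"

definition proper_edge_coloring :: "'a ugraph \<Rightarrow> ('a set \<Rightarrow> nat) \<Rightarrow> bool" where
  "proper_edge_coloring G c \<longleftrightarrow>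
    (\<forall>e\<in>edges G. \<forall>f\<in>edges G. e \<noteq> f \<and> e \<inter> f \<noteq> {} \<longrightarrow> c e \<noteq> c f)"

definition four_cycle :: "'a ugraph \<Rightarrow> 'a \<Rightarrow> 'a \<Rightarrow> 'a \<Rightarrow> 'a \<Rightarrow> bool" where
  "four_cycle G u v w x \<longleftrightarrow> distinct [u, v, w, x] \<and>
    {u, v} \<in> edges G \<and> {v, w} \<in> edges G \<and> {w, x} \<in> edges G \<and> {x, u} \<in> edges G"

definition B_coloring :: "'a ugraph \<Rightarrow> ('a set \<Rightarrow> nat) \<Rightarrow> bool" where
  "B_coloring G c \<longleftrightarrow> proper_edge_coloring G c \<and>
    (\<forall>u v w x. four_cycle G u v w x \<longrightarrow> distinct [c {u, v}, c {v, w}, c {w, x}, c {x, u}])"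

definition q_B :: "'a ugraph \<Rightarrow> nat" where
  "q_B G = (LEAST n. \<exists>c. B_coloring G c \<and> card (c ` edges G) = n)"

text \<open>The minimum in the definition of \<open>q_B\<close> is over a nonempty set.\<close>
lemma B_coloring_exists:
  fixes G :: "'a ugraph"
  assumes "simple_graph G"
  shows "\<exists>c. B_coloring G c"
proof -
  have "edges G \<subseteq> Pow (verts G)" and "finite (verts G)"
    using assms by (auto simp: simple_graph_def)
  then have "finite (edges G)" by (meson finite_Pow_iff finite_subset)
  then obtain c :: "'a set \<Rightarrow> nat" where "inj_on c (edges G)"
    by (metis finite_imp_inj_to_nat_seg)
  then have "B_coloring G c"
    by (auto simp: B_coloring_def proper_edge_coloring_def four_cycle_def inj_on_eq_iff
        doubleton_eq_iff)
  then show ?thesis by blast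
qed

definition complete_bipartite :: "nat \<Rightarrow> nat \<Rightarrow> (nat + nat) ugraph" where
  "complete_bipartite m n =
    \<lparr>verts = {..<m} <+> {..<n}, edges = {{Inl i, Inr j} | i j. i < m \<and> j < n}\<rparr>"

end

theory Submission
  imports Defs
begin

text \<open>
  Delete a vertex \<open>v\<close> of degree at most \<open>k\<close>, color the rest by induction, and then color the
  edges at \<open>v\<close> greedily. A new edge \<open>{v, u}\<close> has to avoid the colors of the edges it touches and
  of the edges opposite to it in a 4-cycle. All of these have one of two forms: \<open>{u, y}\<close> with
  \<open>y \<noteq> v\<close>, of which there are at most \<open>\<Delta> - 1\<close>; or \<open>{w, y}\<close>, where \<open>w \<noteq> u\<close> is a neighbor of \<open>v\<close>
  and \<open>y\<close> is a common neighbor of \<open>u\<close> and \<open>w\<close>. In the second form \<open>y = v\<close> gives the other edges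
  at \<open>v\<close>, and \<open>y \<noteq> v\<close> gives the opposite edge of the 4-cycle \<open>v, u, y, w\<close>. There are at most
  \<open>k - 1\<close> choices of \<open>w\<close> and, for each, at most \<open>min (t - 1) \<Delta>\<close> choices of \<open>y\<close>. Hence fewer than
  \<open>\<Delta> + (k - 1) * min (t - 1) \<Delta>\<close> colors are forbidden (\<open>card_conflicts_le\<close>),
  and a free one remains. Whole vertices have to be removed, not single edges: a 4-cycle through a removed edge would leave its other pair of
  opposite edges unconstrained, whereas a 4-cycle through a removed vertex leaves two
  incident edges.

  For the equality, any two distinct edges of a complete bipartite graph are incident or opposite in
  a 4-cycle, so every B-coloring of it is injective and its B-coloring number is its number of edges.
\<close>

section \<open>B-colorings as colorings of a conflict relation\<close>

definition conflict :: "'a ugraph \<Rightarrow> 'a set \<Rightarrow> 'a set \<Rightarrow> bool" where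
  "conflict G e f \<longleftrightarrow> e \<noteq> f \<and>
    (e \<inter> f \<noteq> {} \<or> (\<exists>u v w x. four_cycle G u v w x \<and> e = {u, v} \<and> f = {w, x}))"

lemma four_cycle_rotate: "four_cycle G u v w x \<Longrightarrow> four_cycle G v w x u"
  unfolding four_cycle_def by (simp add: eq_commute)

lemma conflict_sym:
  assumes "conflict G e f"
  shows "conflict G f e"
proof -
  have "e \<noteq> f" using assms by (simp add: conflict_def)
  from assms consider "e \<inter> f \<noteq> {}"
    | u v w x where "four_cycle G u v w x" "e = {u, v}" "f = {w, x}"
    unfolding conflict_def by blast
  then show ?thesis
  proof cases
    case 1
    then show ?thesis using \<open>e \<noteq> f\<close> by (simp add: conflict_def Int_commute)
  next
    case 2
    then have "four_cycle G w x u v" using four_cycle_rotate[OF four_cycle_rotate[OF 2(1)]] by simp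
    then show ?thesis using \<open>e \<noteq> f\<close> 2 unfolding conflict_def by blast
  qed
qed

lemma B_coloring_iff_conflict:
  "B_coloring G c \<longleftrightarrow>
    (\<forall>e\<in>edges G. \<forall>f\<in>edges G. conflict G e f \<longrightarrow> c e \<noteq> c f)" (is "_ \<longleftrightarrow> ?R")
proof
  assume B: "B_coloring G c"
  show ?R
  proof (intro ballI impI)
    fix e f assume "e \<in> edges G" "f \<in> edges G" "conflict G e f"
    then consider "e \<noteq> f" "e \<inter> f \<noteq> {}"
      | u v w x where "four_cycle G u v w x" "e = {u, v}" "f = {w, x}"
      unfolding conflict_def by blast
    then show "c e \<noteq> c f"
    proof cases
      case 1
      then show ?thesis
        using B \<open>e \<in> edges G\<close> \<open>f \<in> edges G\<close>
        by (simp add: B_coloring_def proper_edge_coloring_def)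
    next
      case 2
      then have "distinct [c {u, v}, c {v, w}, c {w, x}, c {x, u}]"
        using B by (simp add: B_coloring_def)
      then show ?thesis using 2 by simp
    qed
  qed
next
  assume R: ?R
  have "distinct [c {u, v}, c {v, w}, c {w, x}, c {x, u}]" if C: "four_cycle G u v w x" for u v w x
  proof -
    have E: "{u, v} \<in> edges G" "{v, w} \<in> edges G" "{w, x} \<in> edges G" "{x, u} \<in> edges G"
      using C by (simp_all add: four_cycle_def)
    have ne: "u \<noteq> v" "u \<noteq> w" "u \<noteq> x" "v \<noteq> w" "v \<noteq> x" "w \<noteq> x"
      using C by (simp_all add: four_cycle_def)
    have touch: "c e \<noteq> c f"
      if "e \<in> edges G" "f \<in> edges G" "e \<noteq> f" "e \<inter> f \<noteq> {}" for e f
      using R that by (simp add: conflict_def)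
    have opposite: "c {a, b} \<noteq> c {d, e}"
      if "four_cycle G a b d e" "{a, b} \<in> edges G" "{d, e} \<in> edges G" "{a, b} \<noteq> {d, e}"
      for a b d e
    proof -
      have "conflict G {a, b} {d, e}" unfolding conflict_def using that(1,4) by blast
      then show ?thesis using R that(2,3) by blast
    qed
    have "c {u, v} \<noteq> c {v, w}" "c {v, w} \<noteq> c {w, x}" "c {w, x} \<noteq> c {x, u}" "c {u, v} \<noteq> c {x, u}"
      using ne by (intro touch E; auto simp: doubleton_eq_iff)+
    moreover have "c {u, v} \<noteq> c {w, x}" "c {v, w} \<noteq> c {x, u}"
      using ne opposite[OF C] opposite[OF four_cycle_rotate[OF C]] E
      by (simp_all add: doubleton_eq_iff)
    ultimately show ?thesis by simp
  qed
  moreover have "proper_edge_coloring G c"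
    using R by (simp add: proper_edge_coloring_def conflict_def)
  ultimately show "B_coloring G c"
    unfolding B_coloring_def by blast
qed

section \<open>Greedy coloring\<close>

text \<open>
  Color \<open>S\<close> one element at a time: at most \<open>N - 1\<close> colors occur on the elements related to the
  current one. Counting these in all of \<open>E \<union> S\<close> makes the order on \<open>S\<close> irrelevant.
\<close>
lemma greedy_extension:
  fixes c :: "'e \<Rightarrow> nat"
  assumes "finite S" and "finite E" and "S \<inter> E = {}"
    and sym: "\<And>e f. R e f \<Longrightarrow> R f e" and irrefl: "\<And>e. \<not> R e e"
    and few: "\<And>s. s \<in> S \<Longrightarrow> card {f \<in> E \<union> S. R s f} < N"
    and "\<forall>e\<in>E. \<forall>f\<in>E. R e f \<longrightarrow> c e \<noteq> c f" and "c ` E \<subseteq> {..<N}"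
  shows "\<exists>d. (\<forall>e\<in>E \<union> S. \<forall>f\<in>E \<union> S. R e f \<longrightarrow> d e \<noteq> d f) \<and> d ` (E \<union> S) \<subseteq> {..<N}"
  using assms(1,3) few
proof (induction S)
  case empty
  then show ?case using assms(7,8) by auto
next
  case (insert s S)
  have "card {f \<in> E \<union> S. R r f} < N" if "r \<in> S" for r
  proof -
    have "card {f \<in> E \<union> S. R r f} \<le> card {f \<in> E \<union> insert s S. R r f}"
      using insert.hyps assms(2) by (intro card_mono) auto
    then show ?thesis using insert.prems(2)[of r] that by simp
  qed
  then obtain d where d: "\<forall>e\<in>E \<union> S. \<forall>f\<in>E \<union> S. R e f \<longrightarrow> d e \<noteq> d f" "d ` (E \<union> S) \<subseteq> {..<N}"
    using insert.IH insert.prems(1) by auto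
  let ?F = "{f \<in> E \<union> insert s S. R s f}"
  have "card (d ` ?F) < N"
    using insert.prems(2)[of s] card_image_le[of ?F d] insert.hyps assms(2) by simp
  then have "\<not> {..<N} \<subseteq> d ` ?F"
    using card_mono[of "d ` ?F" "{..<N}"] insert.hyps assms(2) by auto
  then obtain n where n: "n < N" "n \<notin> d ` ?F" by auto
  have s: "s \<notin> E \<union> S" using insert.hyps insert.prems(1) by auto
  have "\<forall>e\<in>E \<union> insert s S. \<forall>f\<in>E \<union> insert s S. R e f \<longrightarrow> (d(s := n)) e \<noteq> (d(s := n)) f"
  proof (intro ballI impI)
    fix e f assume ef: "e \<in> E \<union> insert s S" "f \<in> E \<union> insert s S" "R e f"
    have n_ne: "d r \<noteq> n" if "R s r" "r \<in> E \<union> insert s S" for r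
      using n(2) that by blast
    show "(d(s := n)) e \<noteq> (d(s := n)) f"
    proof (cases "e = s \<or> f = s")
      case True
      then show ?thesis
        using ef n_ne[of e] n_ne[of f] sym[OF ef(3)] irrefl[of s] by (metis fun_upd_apply)
    next
      case False
      then show ?thesis using ef d(1) by simp
    qed
  qed
  moreover have "(d(s := n)) ` (E \<union> insert s S) \<subseteq> {..<N}"
    using d(2) n(1) s by auto
  ultimately show ?case by blast
qed

section \<open>Counting the conflicts of an edge\<close>

lemma neighbors_subset_verts: "simple_graph G \<Longrightarrow> neighbors G v \<subseteq> verts G"
  by (auto simp: simple_graph_def neighbors_def)

lemma finite_neighbors: "simple_graph G \<Longrightarrow> finite (neighbors G v)"
  using neighbors_subset_verts[of G v] finite_subset by (auto simp: simple_graph_def)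

lemma finite_edges: "simple_graph G \<Longrightarrow> finite (edges G)"
  by (rule finite_subset[of _ "Pow (verts G)"]) (auto simp: simple_graph_def)

lemma edge_at_vertexE:
  assumes "simple_graph G" and "e \<in> edges G" and "v \<in> e"
  obtains u where "e = {v, u}" and "u \<noteq> v" and "u \<in> neighbors G v"
proof -
  have "card e = 2" using assms by (auto simp: simple_graph_def)
  then obtain u where "e = {v, u}" "u \<noteq> v"
    using assms(3) by (auto simp: card_2_iff)
  then show ?thesis
    using that assms(2) by (auto simp: neighbors_def insert_commute)
qed

text \<open>
  The vertex \<open>v\<close> is itself a common neighbor of \<open>u\<close> and every neighbor \<open>w\<close> of \<open>v\<close>. Therefore
  the edge \<open>{v, w}\<close> is counted together with the edges at \<open>w\<close> opposite to \<open>{v, u}\<close>, and the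
  codegree of \<open>u\<close> and \<open>w\<close> bounds all of them at once.
\<close>
lemma conflicts_subset:
  assumes G: "simple_graph G" and vu: "{v, u} \<in> edges G"
  shows "{f \<in> edges G. conflict G {v, u} f} \<subseteq>
    (\<lambda>y. {u, y}) ` (neighbors G u - {v}) \<union>
    (\<Union>w \<in> neighbors G v - {u}. (\<lambda>y. {w, y}) ` (neighbors G u \<inter> neighbors G w))"
    (is "_ \<subseteq> ?A \<union> ?B")
proof
  fix f assume "f \<in> {f \<in> edges G. conflict G {v, u} f}"
  then have f: "f \<in> edges G" and ne: "f \<noteq> {v, u}" and
    conf: "{v, u} \<inter> f \<noteq> {} \<or>
      (\<exists>a b w x. four_cycle G a b w x \<and> {v, u} = {a, b} \<and> f = {w, x})"
    by (auto simp: conflict_def)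
  consider "u \<in> f" | "v \<in> f"
    | a b w x where "four_cycle G a b w x" "{v, u} = {a, b}" "f = {w, x}"
    using conf by blast
  then show "f \<in> ?A \<union> ?B"
  proof cases
    case 1
    then obtain y where "f = {u, y}" "y \<in> neighbors G u"
      using edge_at_vertexE[OF G f] by blast
    then show ?thesis using ne by (auto simp: insert_commute)
  next
    case 2
    then obtain w where w: "f = {v, w}" "w \<in> neighbors G v"
      using edge_at_vertexE[OF G f] by blast
    then have "w \<noteq> u" "v \<in> neighbors G u \<inter> neighbors G w"
      using ne f vu by (auto simp: neighbors_def insert_commute)
    then have "f \<in> (\<lambda>y. {w, y}) ` (neighbors G u \<inter> neighbors G w)"
      using w(1) by (auto simp: insert_commute)
    then show ?thesis using w(2) \<open>w \<noteq> u\<close> by blast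
  next
    case 3
    \<comment> \<open>The cycle may traverse the edge in either direction; reversing it reduces to \<open>v, u, y, z\<close>.\<close>
    have "\<exists>y z. four_cycle G v u y z \<and> f = {z, y}"
    proof (cases "a = v")
      case True
      then have "b = u" using 3(2) by (auto simp: doubleton_eq_iff)
      then show ?thesis using True 3 by (auto simp: insert_commute)
    next
      case False
      then have "a = u" "b = v" using 3(2) by (auto simp: doubleton_eq_iff)
      moreover have "four_cycle G b a x w"
        using 3(1) by (auto simp: four_cycle_def insert_commute)
      ultimately show ?thesis using 3(3) by blast
    qed
    then obtain y z where yz: "four_cycle G v u y z" "f = {z, y}" by blast
    then have "z \<in> neighbors G v - {u}" "y \<in> neighbors G u \<inter> neighbors G z"
      by (auto simp: four_cycle_def neighbors_def insert_commute)
    then show ?thesis using yz(2) by blast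
  qed
qed

lemma card_conflicts_le:
  assumes G: "simple_graph G" and vu: "{v, u} \<in> edges G"
    and codeg: "\<And>w. w \<in> neighbors G v \<Longrightarrow> w \<noteq> u \<Longrightarrow>
      card (neighbors G u \<inter> neighbors G w) \<le> m"
  shows "card {f \<in> edges G. conflict G {v, u} f} \<le> (degree G u - 1) + (degree G v - 1) * m"
proof -
  let ?A = "(\<lambda>y. {u, y}) ` (neighbors G u - {v})"
  let ?C = "\<lambda>w. (\<lambda>y. {w, y}) ` (neighbors G u \<inter> neighbors G w)"
  let ?W = "neighbors G v - {u}"
  note fin = finite_neighbors[OF G]
  have mem: "v \<in> neighbors G u" "u \<in> neighbors G v"
    using vu by (auto simp: neighbors_def insert_commute)
  have "card ?A \<le> card (neighbors G u - {v})"
    using fin by (intro card_image_le) auto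
  then have A: "card ?A \<le> degree G u - 1"
    using mem fin by (simp add: degree_def)
  have C: "card (?C w) \<le> m" if "w \<in> ?W" for w
    using card_image_le[of "neighbors G u \<inter> neighbors G w" "\<lambda>y. {w, y}"] fin codeg[of w] that
    by fastforce
  have "card (\<Union>w\<in>?W. ?C w) \<le> (\<Sum>w\<in>?W. card (?C w))"
    using fin by (intro card_UN_le) auto
  also have "\<dots> \<le> card ?W * m"
    using sum_bounded_above[of ?W "\<lambda>w. card (?C w)" m] C by auto
  also have "card ?W = degree G v - 1"
    using mem fin by (simp add: degree_def)
  finally have B: "card (\<Union>w\<in>?W. ?C w) \<le> (degree G v - 1) * m" .
  have "card {f \<in> edges G. conflict G {v, u} f} \<le> card (?A \<union> (\<Union>w\<in>?W. ?C w))"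
    using fin by (intro card_mono conflicts_subset[OF G vu]) auto
  also have "\<dots> \<le> card ?A + card (\<Union>w\<in>?W. ?C w)" by (rule card_Un_le)
  also have "\<dots> \<le> (degree G u - 1) + (degree G v - 1) * m" by (rule add_mono[OF A B])
  finally show ?thesis .
qed

section \<open>Coloring degenerate graphs\<close>

definition delete_vertex :: "'a ugraph \<Rightarrow> 'a \<Rightarrow> 'a ugraph" where
  "delete_vertex G v = \<lparr>verts = verts G - {v}, edges = {e \<in> edges G. v \<notin> e}\<rparr>"

lemma delete_vertex_simps [simp]:
  "verts (delete_vertex G v) = verts G - {v}"
  "edges (delete_vertex G v) = {e \<in> edges G. v \<notin> e}"
  by (simp_all add: delete_vertex_def)

lemma simple_graph_delete_vertex: "simple_graph G \<Longrightarrow> simple_graph (delete_vertex G v)"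
  by (auto simp: simple_graph_def)

lemma subgraph_delete_vertex: "simple_graph G \<Longrightarrow> subgraph (delete_vertex G v) G"
  using simple_graph_delete_vertex[of G v] by (auto simp: subgraph_def)

lemma degenerate_subgraph: "degenerate k G \<Longrightarrow> subgraph H G \<Longrightarrow> degenerate k H"
  unfolding degenerate_def subgraph_def by (meson subset_trans)

lemma neighbors_subgraph: "subgraph H G \<Longrightarrow> neighbors H v \<subseteq> neighbors G v"
  by (auto simp: subgraph_def neighbors_def)

lemma degree_subgraph: "simple_graph G \<Longrightarrow> subgraph H G \<Longrightarrow> degree H v \<le> degree G v"
  unfolding degree_def by (intro card_mono finite_neighbors neighbors_subgraph)

text \<open>
  A 4-cycle in which two opposite edges avoid \<open>v\<close> avoids \<open>v\<close> altogether. So colors chosen after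
  deleting \<open>v\<close> stay compatible when \<open>v\<close> is put back.
\<close>
lemma conflict_delete_vertex:
  assumes "conflict G e f" and "v \<notin> e" and "v \<notin> f"
  shows "conflict (delete_vertex G v) e f"
proof -
  have "e \<noteq> f" using assms(1) by (simp add: conflict_def)
  from assms(1) consider "e \<inter> f \<noteq> {}"
    | a b w x where "four_cycle G a b w x" "e = {a, b}" "f = {w, x}"
    unfolding conflict_def by blast
  then show ?thesis
  proof cases
    case 1
    then show ?thesis using \<open>e \<noteq> f\<close> by (simp add: conflict_def)
  next
    case 2
    then have "four_cycle (delete_vertex G v) a b w x"
      using assms(2,3) by (simp add: four_cycle_def)
    then show ?thesis using \<open>e \<noteq> f\<close> 2 unfolding conflict_def by blast
  qed
qed

text \<open>
  The bounds \<open>D\<close> and \<open>m\<close> on degrees and codegrees are fixed numbers rather than the parameters of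
  \<open>G\<close>, since the number of colors must not change when a vertex is deleted.
\<close>
lemma degenerate_B_coloring:
  fixes G :: "'a ugraph"
  assumes "simple_graph G" and "degenerate k G"
    and "\<And>v. v \<in> verts G \<Longrightarrow> degree G v \<le> D"
    and "\<And>u w. u \<in> verts G \<Longrightarrow> w \<in> verts G \<Longrightarrow> u \<noteq> w \<Longrightarrow>
      card (neighbors G u \<inter> neighbors G w) \<le> m"
  shows "\<exists>c. B_coloring G c \<and> c ` edges G \<subseteq> {..<D + (k - 1) * m}"
  using assms
proof (induction "card (verts G)" arbitrary: G)
  case 0
  then have "verts G = {}" by (auto simp: simple_graph_def)
  then have "edges G = {}" using 0(2) by (fastforce simp: simple_graph_def)
  then show ?case by (simp add: B_coloring_iff_conflict)
next
  case (Suc n)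
  note G = Suc.prems(1)
  let ?N = "D + (k - 1) * m"
  have "verts G \<noteq> {}" using Suc.hyps(2) by auto
  moreover have "subgraph G G" using G by (simp add: subgraph_def)
  ultimately obtain v where v: "v \<in> verts G" "degree G v \<le> k"
    using Suc.prems(2) unfolding degenerate_def by blast
  let ?H = "delete_vertex G v"
  note sub = subgraph_delete_vertex[OF G, of v]
  have "\<exists>c. B_coloring ?H c \<and> c ` edges ?H \<subseteq> {..<?N}"
  proof (rule Suc.hyps(1))
    show "n = card (verts ?H)"
      using Suc.hyps(2) v G by (simp add: simple_graph_def)
    show "degree ?H u \<le> D" if "u \<in> verts ?H" for u
      using degree_subgraph[OF G sub, of u] Suc.prems(3)[of u] that by simp
    show "card (neighbors ?H u \<inter> neighbors ?H w) \<le> m"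
      if "u \<in> verts ?H" "w \<in> verts ?H" "u \<noteq> w" for u w
    proof -
      have "card (neighbors ?H u \<inter> neighbors ?H w) \<le> card (neighbors G u \<inter> neighbors G w)"
        using finite_neighbors[OF G] neighbors_subgraph[OF sub] by (intro card_mono) auto
      then show ?thesis using Suc.prems(4)[of u w] that by simp
    qed
  qed (use simple_graph_delete_vertex[OF G] degenerate_subgraph[OF Suc.prems(2) sub]
      in auto)
  then obtain c where c: "B_coloring ?H c" "c ` edges ?H \<subseteq> {..<?N}" by blast
  let ?S = "{e \<in> edges G. v \<in> e}"
  have un: "edges ?H \<union> ?S = edges G" by auto
  have few: "card {f \<in> edges ?H \<union> ?S. conflict G s f} < ?N" if "s \<in> ?S" for s
  proof -
    obtain u where u: "s = {v, u}" "u \<noteq> v" "u \<in> neighbors G v"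
      using \<open>s \<in> ?S\<close> by (auto elim: edge_at_vertexE[OF G])
    have vu: "{v, u} \<in> edges G" using that u by simp
    have "v \<in> neighbors G u" using vu by (simp add: neighbors_def)
    then have "degree G u \<ge> 1"
      using finite_neighbors[OF G] by (auto simp: degree_def Suc_le_eq card_gt_0_iff)
    have nv: "neighbors G v \<subseteq> verts G" using neighbors_subset_verts[OF G] .
    have "card {f \<in> edges G. conflict G {v, u} f} \<le> (degree G u - 1) + (degree G v - 1) * m"
      using card_conflicts_le[OF G vu] Suc.prems(4) nv u(3) by (metis subsetD)
    also have "\<dots> \<le> (degree G u - 1) + (k - 1) * m"
      using v(2) by (simp add: diff_le_mono)
    also have "\<dots> < ?N"
      using \<open>degree G u \<ge> 1\<close> Suc.prems(3)[of u] nv u(3) by fastforce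
    finally show ?thesis using un u(1) by simp
  qed
  have "\<exists>d. (\<forall>e\<in>edges ?H \<union> ?S. \<forall>f\<in>edges ?H \<union> ?S. conflict G e f \<longrightarrow> d e \<noteq> d f) \<and>
      d ` (edges ?H \<union> ?S) \<subseteq> {..<?N}"
  proof (rule greedy_extension)
    show "\<forall>e\<in>edges ?H. \<forall>f\<in>edges ?H. conflict G e f \<longrightarrow> c e \<noteq> c f"
    proof (intro ballI impI)
      fix e f assume ef: "e \<in> edges ?H" "f \<in> edges ?H" "conflict G e f"
      then have "conflict ?H e f" by (simp add: conflict_delete_vertex)
      then show "c e \<noteq> c f" using c(1) ef(1,2) unfolding B_coloring_iff_conflict by blast
    qed
    show "\<not> conflict G e e" for e by (simp add: conflict_def)
    show "conflict G f e" if "conflict G e f" for e f using that by (rule conflict_sym)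
    show "card {f \<in> edges ?H \<union> ?S. conflict G s f} < ?N" if "s \<in> ?S" for s
      using that by (rule few)
    show "c ` edges ?H \<subseteq> {..<?N}" by (rule c(2))
  qed (use finite_edges[OF G] in auto)
  then show ?case unfolding un B_coloring_iff_conflict .
qed

lemma degree_le_max_degree:
  "simple_graph G \<Longrightarrow> v \<in> verts G \<Longrightarrow> degree G v \<le> max_degree G"
  by (auto simp: max_degree_def simple_graph_def intro: Max_ge)

lemma q_B_le:
  assumes "B_coloring G c" and "c ` edges G \<subseteq> {..<n}"
  shows "q_B G \<le> n"
proof -
  have "q_B G \<le> card (c ` edges G)"
    unfolding q_B_def using assms(1) by (intro Least_le) blast
  also have "\<dots> \<le> n" using card_mono[OF _ assms(2)] by simp
  finally show ?thesis .
qed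

lemma q_B_degenerate_K2_free:
  assumes G: "simple_graph G" and "degenerate k G" and "K2_free t G"
  shows "q_B G \<le> max_degree G + (k - 1) * min (t - 1) (max_degree G)"
proof -
  have "card (neighbors G u \<inter> neighbors G w) \<le> min (t - 1) (max_degree G)"
    if "u \<in> verts G" "w \<in> verts G" "u \<noteq> w" for u w
  proof -
    have "card (neighbors G u \<inter> neighbors G w) \<le> degree G u"
      unfolding degree_def using finite_neighbors[OF G] by (intro card_mono) auto
    then show ?thesis
      using assms(3) that degree_le_max_degree[OF G, of u] unfolding K2_free_def by fastforce
  qed
  then show ?thesis
    using degenerate_B_coloring[OF G assms(2) degree_le_max_degree[OF G]] q_B_le by blast
qed

section \<open>Complete bipartite graphs\<close>

lemma complete_bipartite_simps [simp]:
  "verts (complete_bipartite m n) = {..<m} <+> {..<n}"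
  "{Inl i, Inr j} \<in> edges (complete_bipartite m n) \<longleftrightarrow> i < m \<and> j < n"
  "{Inr j, Inl i} \<in> edges (complete_bipartite m n) \<longleftrightarrow> i < m \<and> j < n"
  "{Inl i, Inl i'} \<notin> edges (complete_bipartite m n)"
  "{Inr j, Inr j'} \<notin> edges (complete_bipartite m n)"
  by (auto simp: complete_bipartite_def doubleton_eq_iff)

lemma edges_complete_bipartite:
  "edges (complete_bipartite m n) = (\<lambda>(i, j). {Inl i, Inr j}) ` ({..<m} \<times> {..<n})"
  by (auto simp: complete_bipartite_def)

lemma card_edges_complete_bipartite: "card (edges (complete_bipartite m n)) = m * n"
  unfolding edges_complete_bipartite
  by (subst card_image) (auto simp: inj_on_def doubleton_eq_iff)

lemma simple_graph_complete_bipartite: "simple_graph (complete_bipartite m n)"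
  by (auto simp: simple_graph_def edges_complete_bipartite)

lemma neighbors_complete_bipartite:
  "neighbors (complete_bipartite m n) (Inl i) = (if i < m then Inr ` {..<n} else {})"
  "neighbors (complete_bipartite m n) (Inr j) = (if j < n then Inl ` {..<m} else {})"
proof -
  have "x \<in> neighbors (complete_bipartite m n) (Inl i) \<longleftrightarrow>
      x \<in> (if i < m then Inr ` {..<n} else {})" for x
    by (cases x) (auto simp: neighbors_def)
  then show "neighbors (complete_bipartite m n) (Inl i) = (if i < m then Inr ` {..<n} else {})"
    by blast
  have "x \<in> neighbors (complete_bipartite m n) (Inr j) \<longleftrightarrow>
      x \<in> (if j < n then Inl ` {..<m} else {})" for x
    by (cases x) (auto simp: neighbors_def)
  then show "neighbors (complete_bipartite m n) (Inr j) = (if j < n then Inl ` {..<m} else {})"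
    by blast
qed

lemma degree_complete_bipartite:
  "degree (complete_bipartite m n) (Inl i) = (if i < m then n else 0)"
  "degree (complete_bipartite m n) (Inr j) = (if j < n then m else 0)"
  by (simp_all add: degree_def neighbors_complete_bipartite card_image)

lemma max_degree_complete_bipartite:
  assumes "m \<ge> 1" and "m \<le> n"
  shows "max_degree (complete_bipartite m n) = n"
  unfolding max_degree_def
proof (rule Max_eqI)
  show "n \<in> insert 0 (degree (complete_bipartite m n) ` verts (complete_bipartite m n))"
    using assms by (auto simp: degree_complete_bipartite image_iff intro!: bexI[of _ "Inl 0"])
qed (use assms in \<open>auto simp: degree_complete_bipartite\<close>)

text \<open>
  A subgraph meeting the right side has a vertex there, of degree at most \<open>m\<close>; any other subgraph
  lies in the left side and has no edges.
\<close>
lemma degenerate_complete_bipartite: "degenerate m (complete_bipartite m n)"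
  unfolding degenerate_def
proof (intro allI impI, elim conjE)
  fix H :: "(nat + nat) ugraph"
  let ?K = "complete_bipartite m n"
  assume H: "subgraph H ?K" and ne: "verts H \<noteq> {}"
  show "\<exists>v\<in>verts H. degree H v \<le> m"
  proof (cases "\<exists>j. Inr j \<in> verts H")
    case True
    then obtain j where j: "Inr j \<in> verts H" by blast
    have "degree H (Inr j) \<le> degree ?K (Inr j)"
      by (rule degree_subgraph[OF simple_graph_complete_bipartite H])
    then have "degree H (Inr j) \<le> m"
      by (auto simp: degree_complete_bipartite split: if_splits)
    with j show ?thesis by blast
  next
    case False
    obtain v where v: "v \<in> verts H" using ne by blast
    then obtain i where i: "v = Inl i" using False by (cases v) auto
    have "neighbors H v \<subseteq> verts H"
      using H by (intro neighbors_subset_verts) (simp add: subgraph_def)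
    moreover have "neighbors H v \<subseteq> range Inr"
      using neighbors_subgraph[OF H, of v]
      by (auto simp: i neighbors_complete_bipartite split: if_splits)
    ultimately have "neighbors H v = {}" using False by blast
    then have "degree H v \<le> m" by (simp add: degree_def)
    with v show ?thesis by blast
  qed
qed

lemma K2_free_complete_bipartite:
  assumes "m \<le> n" and "n \<le> t - 1"
  shows "K2_free t (complete_bipartite m n)"
proof -
  have "Inr ` A \<inter> Inl ` B = ({} :: (nat + nat) set)"
    "Inl ` B \<inter> Inr ` A = ({} :: (nat + nat) set)" for A B
    by auto
  then show ?thesis
    using assms by (auto simp: K2_free_def neighbors_complete_bipartite card_image)
qed

lemma conflict_complete_bipartite:
  assumes e: "e \<in> edges (complete_bipartite m n)" and f: "f \<in> edges (complete_bipartite m n)"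
    and "e \<noteq> f"
  shows "conflict (complete_bipartite m n) e f"
proof -
  obtain i j where ij: "e = {Inl i, Inr j}" "i < m" "j < n"
    using e by (auto simp: edges_complete_bipartite)
  obtain i' j' where ij': "f = {Inl i', Inr j'}" "i' < m" "j' < n"
    using f by (auto simp: edges_complete_bipartite)
  show ?thesis
  proof (cases "i = i' \<or> j = j'")
    case True
    then show ?thesis using \<open>e \<noteq> f\<close> ij(1) ij'(1) by (auto simp: conflict_def)
  next
    case False
    then have "four_cycle (complete_bipartite m n) (Inl i) (Inr j) (Inl i') (Inr j')"
      using ij ij' by (auto simp: four_cycle_def)
    then show ?thesis using \<open>e \<noteq> f\<close> ij(1) ij'(1) unfolding conflict_def by blast
  qed
qed

lemma q_B_complete_bipartite: "q_B (complete_bipartite m n) = m * n"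
proof -
  let ?K = "complete_bipartite m n"
  have card: "card (c ` edges ?K) = m * n" if "B_coloring ?K c" for c
  proof -
    have "inj_on c (edges ?K)"
      using that conflict_complete_bipartite unfolding B_coloring_iff_conflict inj_on_def by blast
    then show ?thesis by (simp add: card_image card_edges_complete_bipartite)
  qed
  obtain c where "B_coloring ?K c"
    using B_coloring_exists[OF simple_graph_complete_bipartite] by blast
  then show ?thesis
    unfolding q_B_def using card by (intro Least_equality) auto
qed

section \<open>The bound and its sharpness\<close>

theorem theorem4p1:
  fixes k t :: nat
  assumes "k \<ge> 1" and "t \<ge> 2"
  shows "(\<forall>G :: 'a ugraph. simple_graph G \<and> degenerate k G \<and> K2_free t G \<longrightarrow>
            q_B G \<le> max_degree G + (k - 1) * min (t - 1) (max_degree G))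
       \<and> (k \<ge> 2 \<and> t - 1 \<ge> k \<longrightarrow>
            simple_graph (complete_bipartite k (t - 1))
          \<and> degenerate k (complete_bipartite k (t - 1))
          \<and> K2_free t (complete_bipartite k (t - 1))
          \<and> q_B (complete_bipartite k (t - 1)) =
              max_degree (complete_bipartite k (t - 1)) +
              (k - 1) * min (t - 1) (max_degree (complete_bipartite k (t - 1))))"
proof (intro conjI allI impI)
  fix G :: "'a ugraph"
  assume "simple_graph G \<and> degenerate k G \<and> K2_free t G"
  then show "q_B G \<le> max_degree G + (k - 1) * min (t - 1) (max_degree G)"
    using q_B_degenerate_K2_free by blast
next
  assume "k \<ge> 2 \<and> t - 1 \<ge> k"
  then have kt: "k \<ge> 1" "k \<le> t - 1" by auto
  show "simple_graph (complete_bipartite k (t - 1))"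
    by (rule simple_graph_complete_bipartite)
  show "degenerate k (complete_bipartite k (t - 1))"
    by (rule degenerate_complete_bipartite)
  show "K2_free t (complete_bipartite k (t - 1))"
    by (rule K2_free_complete_bipartite[OF kt(2)]) simp
  obtain l where l: "k = Suc l" using kt(1) by (cases k) auto
  show "q_B (complete_bipartite k (t - 1)) =
      max_degree (complete_bipartite k (t - 1)) +
      (k - 1) * min (t - 1) (max_degree (complete_bipartite k (t - 1)))"
    unfolding q_B_complete_bipartite max_degree_complete_bipartite[OF kt] by (simp add: l)
qed

end
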